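(* Let $\alpha>0$, $A\ge0$, $B>0$, $t>0$, $w(x,t)=x^\alpha e^{-x}(A+B\theta(x-t))$ on $[0,\infty)$, $D_n(t)=\det\left(\int_0^\infty x^{i+j}w(x,t)dx\right)_{i,j=0}^{n-1}$, and $H_n(t):=t\frac{d}{dt}\ln D_n(t)$. Then for $n\ge1$ $$(tH_n'')^2=4(H_n')^2\left[H_n-n(n+\alpha)-tH_n'\right]+\left[(2n+\alpha-t)H_n'+H_n\right]^2.$$
   Context: $\theta$ is the Heaviside function ($1$ for $x>0$, $0$ otherwise); primes denote $d/dt$. *)

theory Defs
  imports "HOL-Analysis.Analysis" "Jordan_Normal_Form.Determinant"
begin

definition heaviside :: "real \<Rightarrow> real" where
  "heaviside x = (if x > 0 then 1 else 0)"

definition wt :: "real \<Rightarrow> real \<Rightarrow> real \<Rightarrow> real \<Rightarrow> real \<Rightarrow> real" where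
  "wt \<alpha> A B t x = x powr \<alpha> * exp (- x) * (A + B * heaviside (x - t))"

definition moment :: "real \<Rightarrow> real \<Rightarrow> real \<Rightarrow> real \<Rightarrow> nat \<Rightarrow> real" where
  "moment \<alpha> A B t k = integral {0..} (\<lambda>x. x ^ k * wt \<alpha> A B t x)"

definition hankelD :: "real \<Rightarrow> real \<Rightarrow> real \<Rightarrow> nat \<Rightarrow> real \<Rightarrow> real" where
  "hankelD \<alpha> A B n t = det (mat n n (\<lambda>(i, j). moment \<alpha> A B t (i + j)))"

definition Hn :: "real \<Rightarrow> real \<Rightarrow> real \<Rightarrow> nat \<Rightarrow> real \<Rightarrow> real" where
  "Hn \<alpha> A B n t = t * deriv (\<lambda>s. ln (hankelD \<alpha> A B n s)) t"

end

theory Submission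
  imports Defs
begin

text \<open>
  Let \<open>P\<^sub>k\<close> be the monic orthogonal polynomials of the weight, \<open>h\<^sub>k\<close> their squared norms,
  \<open>c = B t\<^sup>\<alpha> e\<^sup>-\<^sup>t\<close> the size of the jump, and write \<open>P = P\<^sub>n\<close>, \<open>Q = P\<^sub>n\<^sub>-\<^sub>1\<close>, \<open>g = h\<^sub>n\<^sub>-\<^sub>1\<close>,
  \<open>b = h\<^sub>n / g\<close>. The moments satisfy \<open>\<mu>\<^sub>k' = - c t\<^sup>k\<close> and \<open>\<mu>\<^sub>k\<^sub>+\<^sub>1 = (k + 1 + \<alpha>) \<mu>\<^sub>k - t \<mu>\<^sub>k'\<close>; the
  second relation expresses the homogeneity of the weight up to the factor \<open>e\<^sup>-\<^sup>x\<close>, and turns into the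
  ladder equation \<open>(x \<partial>\<^sub>x + t \<partial>\<^sub>t) P = n P + b Q\<close>.

  Since the determinant is the product of the norms, \<open>H = - t c \<Sum>\<^sub>j\<^sub><\<^sub>n P\<^sub>j(t)\<^sup>2 / h\<^sub>j\<close>, and this is
  \<open>n (n + \<alpha>)\<close> plus the subleading coefficient of \<open>P\<close>. With \<open>p = P(t)\<close> and \<open>q = Q(t)\<close> one finds
  \<open>H' = c p q / g\<close>, \<open>t H'' = c (b q\<^sup>2 - p\<^sup>2) / g\<close>, \<open>b = n (n + \<alpha>) - H + t H'\<close>, and the confluent
  Christoffel-Darboux formula gives \<open>c (b q\<^sup>2 + p\<^sup>2) / g = - ((2 n + \<alpha> - t) H' + H)\<close>. The theorem is
  the identity \<open>(b q\<^sup>2 - p\<^sup>2)\<^sup>2 = (b q\<^sup>2 + p\<^sup>2)\<^sup>2 - 4 b p\<^sup>2 q\<^sup>2\<close>.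
\<close>

hide_const (open) Module.smult

section \<open>Moment functionals and their monic orthogonal polynomials\<close>

text \<open>Integration against a weight is encoded by its moment sequence, so that dependence on a
  parameter is a matter of finite sums and no differentiation under the integral sign
  arises.\<close>

definition mfun :: "(nat \<Rightarrow> real) \<Rightarrow> real poly \<Rightarrow> real" where
  "mfun \<mu> f = (\<Sum>i\<le>degree f. coeff f i * \<mu> i)"

lemma mfun_altdef:
  assumes "degree f \<le> N"
  shows "mfun \<mu> f = (\<Sum>i\<le>N. coeff f i * \<mu> i)"
  unfolding mfun_def
  by (rule sum.mono_neutral_left) (use assms in \<open>auto simp: coeff_eq_0\<close>)

lemma mfun_0 [simp]: "mfun \<mu> 0 = 0"
  by (simp add: mfun_def)

lemma mfun_add: "mfun \<mu> (f + g) = mfun \<mu> f + mfun \<mu> g"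
proof -
  define N where "N = max (degree f) (degree g)"
  have "degree f \<le> N" "degree g \<le> N" "degree (f + g) \<le> N"
    by (auto simp: N_def intro: degree_add_le)
  then show ?thesis
    by (simp add: mfun_altdef[of _ N] sum.distrib algebra_simps)
qed

lemma mfun_smult: "mfun \<mu> (smult c f) = c * mfun \<mu> f"
  by (simp add: mfun_altdef[OF degree_smult_le] mfun_def sum_distrib_left mult_ac)

lemma mfun_diff: "mfun \<mu> (f - g) = mfun \<mu> f - mfun \<mu> g"
  using mfun_add[of \<mu> f "smult (-1) g"] mfun_smult[of \<mu> "-1" g] by simp

lemmas mfun_linear = mfun_add mfun_diff mfun_smult

lemma mfun_sum: "mfun \<mu> (\<Sum>i\<in>S. f i) = (\<Sum>i\<in>S. mfun \<mu> (f i))"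
  by (induction S rule: infinite_finite_induct) (auto simp: mfun_add)

text \<open>The recurrence coefficient of \<open>mop \<mu> (n - 1)\<close> is set to zero at \<open>n = 0\<close>, where \<open>n - 1\<close> is truncated.\<close>

function mop :: "(nat \<Rightarrow> real) \<Rightarrow> nat \<Rightarrow> real poly" where
  "mop \<mu> 0 = 1"
| "mop \<mu> (Suc n) =
     pCons 0 (mop \<mu> n)
     - smult (mfun \<mu> (pCons 0 (mop \<mu> n * mop \<mu> n)) / mfun \<mu> (mop \<mu> n * mop \<mu> n)) (mop \<mu> n)
     - smult (if n = 0 then 0 else
         mfun \<mu> (mop \<mu> n * mop \<mu> n) / mfun \<mu> (mop \<mu> (n - 1) * mop \<mu> (n - 1))) (mop \<mu> (n - 1))"
  by pat_completeness auto
termination by (relation "Wellfounded.measure snd") auto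

declare mop.simps(2) [simp del]

definition mnorm :: "(nat \<Rightarrow> real) \<Rightarrow> nat \<Rightarrow> real" where
  "mnorm \<mu> n = mfun \<mu> (mop \<mu> n * mop \<mu> n)"

definition rec_a :: "(nat \<Rightarrow> real) \<Rightarrow> nat \<Rightarrow> real" where
  "rec_a \<mu> n = mfun \<mu> (pCons 0 (mop \<mu> n * mop \<mu> n)) / mnorm \<mu> n"

definition rec_b :: "(nat \<Rightarrow> real) \<Rightarrow> nat \<Rightarrow> real" where
  "rec_b \<mu> n = (if n = 0 then 0 else mnorm \<mu> n / mnorm \<mu> (n - 1))"

lemma mop_Suc:
  "mop \<mu> (Suc n) = pCons 0 (mop \<mu> n) - smult (rec_a \<mu> n) (mop \<mu> n) - smult (rec_b \<mu> n) (mop \<mu> (n - 1))"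
  by (simp only: mop.simps(2) rec_a_def rec_b_def mnorm_def)

lemma mop_monic: "degree (mop \<mu> n) \<le> n \<and> coeff (mop \<mu> n) n = 1"
proof (induction n rule: less_induct)
  case (less n)
  show ?case
  proof (cases n)
    case (Suc k)
    have k: "degree (mop \<mu> k) \<le> k" "coeff (mop \<mu> k) k = 1"
      using less.IH[of k] Suc by auto
    have "degree (mop \<mu> (k - 1)) \<le> k - 1"
      using less.IH[of "k - 1"] Suc by (simp add: less_Suc_eq_le)
    then have k': "degree (mop \<mu> (k - 1)) \<le> k" by linarith
    have "degree (pCons 0 (mop \<mu> k)) \<le> Suc k"
      using k by (simp add: degree_pCons_eq_if)
    moreover have "degree (smult c (mop \<mu> k)) \<le> Suc k" "degree (smult c (mop \<mu> (k - 1))) \<le> Suc k" for c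
      using k k' degree_smult_le[of c "mop \<mu> k"] degree_smult_le[of c "mop \<mu> (k - 1)"] by linarith+
    ultimately have "degree (mop \<mu> (Suc k)) \<le> Suc k"
      unfolding mop_Suc by (intro degree_diff_le) auto
    moreover have "coeff (mop \<mu> (Suc k)) (Suc k) = 1"
      unfolding mop_Suc using k k' by (simp add: coeff_eq_0)
    ultimately show ?thesis using Suc by simp
  qed simp
qed

lemma degree_mop_le: "degree (mop \<mu> n) \<le> n" and coeff_mop_self [simp]: "coeff (mop \<mu> n) n = 1"
  using mop_monic by blast+

lemma coeff_mop_eq_0: "n < i \<Longrightarrow> coeff (mop \<mu> n) i = 0"
  by (rule coeff_eq_0) (use degree_mop_le[of \<mu> n] in linarith)

lemma mop_nonzero [simp]: "mop \<mu> n \<noteq> 0"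
  using coeff_mop_self[of \<mu> n] by fastforce

text \<open>Each recurrence step lowers the subleading coefficient by \<open>rec_a\<close>; the
  \<open>rec_b\<close> term has too low a degree to contribute.\<close>

lemma coeff_mop_subleading: "coeff (mop \<mu> (Suc n)) n = - (\<Sum>j\<le>n. rec_a \<mu> j)"
proof (induction n)
  case (Suc n)
  then show ?case
    by (subst mop_Suc) (simp add: coeff_mop_eq_0)
qed (simp add: mop_Suc rec_b_def)

lemma poly_mop_Suc:
  "poly (mop \<mu> (Suc n)) x = (x - rec_a \<mu> n) * poly (mop \<mu> n) x - rec_b \<mu> n * poly (mop \<mu> (n - 1)) x"
  unfolding mop_Suc by (simp add: algebra_simps)

lemma poly_pderiv_mop_Suc:
  "poly (pderiv (mop \<mu> (Suc n))) x = poly (mop \<mu> n) x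
     + (x - rec_a \<mu> n) * poly (pderiv (mop \<mu> n)) x - rec_b \<mu> n * poly (pderiv (mop \<mu> (n - 1))) x"
  unfolding mop_Suc by (simp add: pderiv_diff pderiv_smult pderiv_pCons left_diff_distrib)

section \<open>Positive functionals: orthogonality, expansion, Christoffel-Darboux\<close>

locale pos_functional =
  fixes \<mu> :: "nat \<Rightarrow> real"
  assumes mfun_square_pos: "f \<noteq> 0 \<Longrightarrow> mfun \<mu> (f * f) > 0"
begin

abbreviation "L \<equiv> mfun \<mu>"
abbreviation "P \<equiv> mop \<mu>"
abbreviation "h \<equiv> mnorm \<mu>"

lemma h_pos: "h n > 0"
  unfolding mnorm_def by (rule mfun_square_pos) simp

lemma h_nonzero [simp]: "h n \<noteq> 0"
  using h_pos[of n] by simp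

lemma rec_a_h: "rec_a \<mu> n * h n = L (pCons 0 (P n * P n))"
  by (simp add: rec_a_def)

lemma rec_b_h: "rec_b \<mu> (Suc n) * h n = h (Suc n)"
  by (simp add: rec_b_def)

lemma pCons_mop: "pCons 0 (P n) = P (Suc n) + smult (rec_a \<mu> n) (P n) + smult (rec_b \<mu> n) (P (n - 1))"
  by (simp add: mop_Suc)

text \<open>By strong induction. After multiplication by x is moved to \<open>P j\<close>, only the
  indices k and k - 1 leave terms, and \<open>rec_a\<close> and \<open>rec_b\<close> are chosen to
  cancel these.\<close>

lemma mop_orthogonal: "j < n \<Longrightarrow> L (P n * P j) = 0"
proof (induction n arbitrary: j rule: less_induct)
  case (less n)
  then obtain k where n: "n = Suc k" by (cases n) auto
  have IH: "L (P i * P j) = 0" if "i < n" "j < i" for i j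
    using less.IH that by blast
  have IH': "L (P i * P j) = 0" if "j < n" "i < j" for i j
    using IH[of j i] that by (simp add: mult.commute)
  have split: "L (P n * P j) = L (P k * pCons 0 (P j)) - rec_a \<mu> k * L (P k * P j)
      - rec_b \<mu> k * L (P (k - 1) * P j)" for j
    by (simp add: n mop_Suc left_diff_distrib mfun_linear)
  have L2: "L (P k * pCons 0 (P j)) = L (P k * P (Suc j)) + rec_a \<mu> j * L (P k * P j)
      + rec_b \<mu> j * L (P k * P (j - 1))" for j
    by (simp add: pCons_mop[of j] distrib_left mfun_linear del: mult_pCons_right)
  consider "j = k" | "Suc j = k" | "Suc j < k" using less.prems n by linarith
  then show ?case
  proof cases
    case 1
    \<comment> \<open>At k = 0 the truncated index k - 1 equals k, and the term vanishes only
      because \<open>rec_b\<close> is zero there.\<close>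
    have "rec_b \<mu> k * L (P (k - 1) * P k) = 0"
      by (cases k) (auto simp: rec_b_def intro!: IH' simp: n)
    then show ?thesis unfolding split using 1 rec_a_h[of k] by (simp add: mnorm_def)
  next
    case 2
    have "L (P k * P j) = 0" "L (P k * P (j - 1)) = 0"
      using 2 n by (auto intro!: IH)
    then have "L (P k * pCons 0 (P j)) = h k"
      unfolding L2 using 2 by (simp add: mnorm_def)
    moreover have "rec_b \<mu> k * L (P (k - 1) * P j) = h k"
      using rec_b_h[of j] 2 by (auto simp: mnorm_def)
    ultimately show ?thesis unfolding split using \<open>L (P k * P j) = 0\<close> by simp
  next
    case 3
    have "L (P k * P j) = 0" "L (P k * P (j - 1)) = 0" "L (P k * P (Suc j)) = 0"
         "L (P (k - 1) * P j) = 0"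
      using 3 n by (auto intro!: IH)
    then show ?thesis unfolding split L2 by simp
  qed
qed

lemma mop_orthogonal': "j < n \<Longrightarrow> L (P j * P n) = 0"
  using mop_orthogonal[of j n] by (simp add: mult.commute)

lemma mfun_span_mop: "L ((\<Sum>j<n. smult (c j) (P j)) * P n) = 0"
  unfolding sum_distrib_right mfun_sum
  by (intro sum.neutral) (auto simp: mfun_linear mop_orthogonal')

text \<open>Peel off the leading term and induct. Vanishing of the coefficients from n on, unlike
  \<open>degree f < n\<close>, also allows n = 0, where f is zero.\<close>

lemma mop_expansion:
  assumes "\<And>i. n \<le> i \<Longrightarrow> coeff f i = 0"
  shows "f = (\<Sum>j<n. smult (L (f * P j) / h j) (P j))"
  using assms
proof (induction n arbitrary: f)
  case 0
  then show ?case by (simp add: poly_eq_iff)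
next
  case (Suc n)
  define c where "c = coeff f n"
  define g where "g = f - smult c (P n)"
  have "coeff g i = 0" if "n \<le> i" for i
    using that Suc.prems[of i] by (cases "i = n") (auto simp: g_def c_def coeff_mop_eq_0)
  note g = Suc.IH[OF this]
  have "L (g * P n) = 0"
    by (subst g, assumption, rule mfun_span_mop)
  then have "L (f * P n) = c * h n"
    by (simp add: g_def left_diff_distrib mfun_linear mnorm_def)
  moreover have "L (g * P j) = L (f * P j)" if "j < n" for j
    using that by (simp add: g_def left_diff_distrib mfun_linear mop_orthogonal)
  ultimately show ?case
    using g by (simp add: g_def algebra_simps)
qed

lemma mop_orthogonal_lower:
  assumes "\<And>i. n \<le> i \<Longrightarrow> coeff f i = 0"
  shows "L (f * P n) = 0"
  by (subst mop_expansion[OF assms], assumption, rule mfun_span_mop)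

lemma mfun_mult_mop:
  assumes "\<And>i. n < i \<Longrightarrow> coeff f i = 0"
  shows "L (f * P n) = coeff f n * h n"
proof -
  have "L ((f - smult (coeff f n) (P n)) * P n) = 0"
  proof (rule mop_orthogonal_lower)
    fix i assume "n \<le> i"
    then show "coeff (f - smult (coeff f n) (P n)) i = 0"
      using assms[of i] by (cases "i = n") (auto simp: coeff_mop_eq_0)
  qed
  then show ?thesis by (simp add: left_diff_distrib mfun_linear mnorm_def)
qed

text \<open>The limit form of the Christoffel-Darboux formula at coinciding arguments, obtained
  without a limit by induction with the three-term recurrence and its derivative.\<close>

lemma christoffel_darboux_confluent:
  "h n * (\<Sum>j\<le>n. (poly (P j) x)\<^sup>2 / h j) =
     poly (pderiv (P (Suc n))) x * poly (P n) x - poly (P (Suc n)) x * poly (pderiv (P n)) x"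
proof (induction n)
  case 0
  then show ?case by (simp add: mop_Suc rec_b_def pderiv_diff pderiv_smult pderiv_pCons)
next
  case (Suc n)
  define S where "S = (\<Sum>j\<le>n. (poly (P j) x)\<^sup>2 / h j)"
  have "h (Suc n) * (\<Sum>j\<le>Suc n. (poly (P j) x)\<^sup>2 / h j) = (poly (P (Suc n)) x)\<^sup>2 + rec_b \<mu> (Suc n) * (h n * S)"
    by (simp add: S_def[symmetric] distrib_left rec_b_h flip: mult.assoc)
  also have "\<dots> = poly (pderiv (P (Suc (Suc n)))) x * poly (P (Suc n)) x - poly (P (Suc (Suc n))) x * poly (pderiv (P (Suc n))) x"
    unfolding S_def Suc.IH
    unfolding poly_mop_Suc[of _ "Suc n"] poly_pderiv_mop_Suc[of _ "Suc n"]
    by (simp add: algebra_simps power2_eq_square)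
  finally show ?case .
qed

end

section \<open>The Hankel determinant as the product of the norms\<close>

lemma mfun_monom: "mfun \<mu> (monom c k) = c * \<mu> k"
proof -
  have "mfun \<mu> (monom c k) = (\<Sum>i\<le>k. if i = k then c * \<mu> k else 0)"
    unfolding mfun_altdef[OF degree_monom_le] by (intro sum.cong) auto
  then show ?thesis by simp
qed

lemma mfun_mult_hankel:
  assumes "degree p < n" "degree q < n"
  shows "mfun \<mu> (p * q) = (\<Sum>l<n. (\<Sum>k<n. coeff p k * \<mu> (k + l)) * coeff q l)"
proof -
  have "p = (\<Sum>k<n. monom (coeff p k) k)" "q = (\<Sum>l<n. monom (coeff q l) l)"
    using poly_as_sum_of_monoms'[of p "n - 1"] poly_as_sum_of_monoms'[of q "n - 1"] assms
      lessThan_Suc_atMost[of "n - 1"] by (simp_all add: Suc_diff_Suc)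
  then have "mfun \<mu> (p * q) = mfun \<mu> ((\<Sum>k<n. monom (coeff p k) k) * (\<Sum>l<n. monom (coeff q l) l))"
    by simp
  also have "\<dots> = (\<Sum>k<n. \<Sum>l<n. coeff p k * coeff q l * \<mu> (k + l))"
    by (simp add: sum_product mfun_sum mult_monom mfun_monom)
  also have "\<dots> = (\<Sum>l<n. \<Sum>k<n. coeff p k * coeff q l * \<mu> (k + l))"
    by (rule sum.swap)
  finally show ?thesis by (simp add: sum_distrib_left sum_distrib_right mult_ac)
qed

text \<open>Passing from monomials to the monic \<open>P k\<close> is a unitriangular change of
  basis: it keeps the determinant and makes the Gram matrix diagonal.\<close>

lemma (in pos_functional) hankel_det:
  "det (mat n n (\<lambda>(i, j). \<mu> (i + j))) = (\<Prod>k<n. h k)"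
proof -
  define M where "M = mat n n (\<lambda>(i, j). \<mu> (i + j))"
  define C where "C = mat n n (\<lambda>(i, j). coeff (P i) j)"
  have [simp]: "M \<in> carrier_mat n n" "C \<in> carrier_mat n n"
    by (auto simp: M_def C_def)
  have entry: "(C * M * transpose_mat C) $$ (i, j) = L (P i * P j)" if "i < n" "j < n" for i j
  proof -
    have "degree (P i) < n" "degree (P j) < n"
      using that degree_mop_le[of \<mu> i] degree_mop_le[of \<mu> j] by linarith+
    then show ?thesis
      using that by (simp add: mfun_mult_hankel scalar_prod_def M_def C_def atLeast0LessThan)
  qed
  have dims: "dim_row C = n"
    by (simp add: C_def)
  have "det C = prod_list (diag_mat C)"
    by (rule det_lower_triangular[of n]) (auto simp: C_def coeff_mop_eq_0)
  also have "\<dots> = 1"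
    by (simp add: prod_list_diag_prod C_def)
  finally have C: "det C = 1" .
  have "det (C * M * transpose_mat C) = prod_list (diag_mat (C * M * transpose_mat C))"
  proof (rule det_lower_triangular)
    fix i j assume "i < j" "j < n"
    then show "(C * M * transpose_mat C) $$ (i, j) = 0"
      using mop_orthogonal[of i j] by (simp add: entry mult.commute)
  qed (auto intro!: mult_carrier_mat[of _ n n])
  also have "\<dots> = (\<Prod>k<n. h k)"
    unfolding prod_list_diag_prod
    by (intro prod.cong) (auto simp: dims entry mnorm_def simp del: index_mult_mat(1))
  also have "det (C * M * transpose_mat C) = det (C * M) * det (transpose_mat C)"
    by (rule det_mult[of _ n]) (auto intro!: mult_carrier_mat[of _ n n])
  also have "\<dots> = det M"
    using det_mult[of C n M] det_transpose[of C n] by (simp add: C)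
  finally show ?thesis by (simp add: M_def)
qed

section \<open>Families of polynomials depending on a parameter\<close>

text \<open>Differentiation at fixed x, coefficient by coefficient. The uniform degree bound lets
  evaluations and functionals be finite sums over a range independent of s.\<close>

definition poly_has_deriv :: "(real \<Rightarrow> real poly) \<Rightarrow> real poly \<Rightarrow> real \<Rightarrow> bool" where
  "poly_has_deriv F F' t \<longleftrightarrow> (\<exists>N. \<forall>s. degree (F s) \<le> N) \<and>
     (\<forall>i. ((\<lambda>s. coeff (F s) i) has_real_derivative coeff F' i) (at t))"

lemma poly_has_deriv_const: "poly_has_deriv (\<lambda>_. f) 0 t"
  by (auto simp: poly_has_deriv_def)

lemma poly_has_deriv_diff:
  assumes "poly_has_deriv F F' t" "poly_has_deriv G G' t"
  shows "poly_has_deriv (\<lambda>s. F s - G s) (F' - G') t"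
proof -
  obtain N M where "\<forall>s. degree (F s) \<le> N" "\<forall>s. degree (G s) \<le> M"
    using assms by (auto simp: poly_has_deriv_def)
  then have "\<forall>s. degree (F s - G s) \<le> max N M"
    by (intro allI degree_diff_le) (auto simp: le_max_iff_disj)
  then show ?thesis
    using assms by (auto simp: poly_has_deriv_def intro!: DERIV_diff)
qed

lemma poly_has_deriv_smult:
  assumes "(u has_real_derivative u') (at t)" "poly_has_deriv F F' t"
  shows "poly_has_deriv (\<lambda>s. smult (u s) (F s)) (smult u' (F t) + smult (u t) F') t"
proof -
  obtain N where "\<forall>s. degree (F s) \<le> N"
    using assms by (auto simp: poly_has_deriv_def)
  then have "\<forall>s. degree (smult (u s) (F s)) \<le> N"
    using degree_smult_le order.trans by blast
  moreover have "((\<lambda>s. u s * coeff (F s) i) has_real_derivative u' * coeff (F t) i + u t * coeff F' i) (at t)" for i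
    using DERIV_mult[OF assms(1), of "\<lambda>s. coeff (F s) i" "coeff F' i"] assms(2)
    by (simp add: poly_has_deriv_def mult.commute)
  ultimately show ?thesis
    unfolding poly_has_deriv_def by (auto simp del: degree_smult_eq)
qed

lemma poly_has_deriv_pCons_0:
  assumes "poly_has_deriv F F' t"
  shows "poly_has_deriv (\<lambda>s. pCons 0 (F s)) (pCons 0 F') t"
proof -
  obtain N where "\<forall>s. degree (F s) \<le> N"
    using assms by (auto simp: poly_has_deriv_def)
  then have "\<forall>s. degree (pCons 0 (F s)) \<le> Suc N"
    by (simp add: degree_pCons_eq_if)
  moreover have "((\<lambda>s. coeff (pCons 0 (F s)) i) has_real_derivative coeff (pCons 0 F') i) (at t)" for i
    using assms by (cases i) (auto simp: poly_has_deriv_def)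
  ultimately show ?thesis
    unfolding poly_has_deriv_def by blast
qed

lemma poly_has_deriv_mult:
  assumes "poly_has_deriv F F' t" "poly_has_deriv G G' t"
  shows "poly_has_deriv (\<lambda>s. F s * G s) (F' * G t + F t * G') t"
proof -
  obtain N M where NM: "\<forall>s. degree (F s) \<le> N" "\<forall>s. degree (G s) \<le> M"
    using assms by (auto simp: poly_has_deriv_def)
  have "degree (F s * G s) \<le> N + M" for s
    using degree_mult_le[of "F s" "G s"] NM by (meson add_mono order.trans)
  moreover have "((\<lambda>s. coeff (F s * G s) i) has_real_derivative coeff (F' * G t + F t * G') i) (at t)" for i
  proof -
    have "((\<lambda>s. \<Sum>j\<le>i. coeff (F s) j * coeff (G s) (i - j)) has_real_derivative
        (\<Sum>j\<le>i. coeff F' j * coeff (G t) (i - j) + coeff G' (i - j) * coeff (F t) j)) (at t)"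
      by (rule DERIV_sum, rule DERIV_mult) (use assms in \<open>auto simp: poly_has_deriv_def\<close>)
    then show ?thesis
      by (simp add: coeff_mult sum.distrib mult.commute[of "coeff G' _"])
  qed
  ultimately show ?thesis
    by (auto simp: poly_has_deriv_def)
qed

lemma mfun_has_deriv:
  assumes "\<And>i. ((\<lambda>s. m s i) has_real_derivative m' i) (at t)" "poly_has_deriv F F' t"
  shows "((\<lambda>s. mfun (m s) (F s)) has_real_derivative mfun (m t) F' + mfun m' (F t)) (at t)"
proof -
  obtain N where N: "\<And>s. degree (F s) \<le> N"
    and F: "\<And>i. ((\<lambda>s. coeff (F s) i) has_real_derivative coeff F' i) (at t)"
    using assms(2) by (auto simp: poly_has_deriv_def)
  have "coeff F' i = 0" if "N < i" for i
  proof -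
    have "coeff (F s) i = 0" for s
      by (rule coeff_eq_0) (use N[of s] that in linarith)
    then show ?thesis
      using DERIV_unique[OF F[of i], of 0] by simp
  qed
  then have N': "degree F' \<le> N"
    by (intro degree_le) auto
  have "((\<lambda>s. \<Sum>i\<le>N. coeff (F s) i * m s i) has_real_derivative
      (\<Sum>i\<le>N. coeff F' i * m t i + m' i * coeff (F t) i)) (at t)"
    by (intro DERIV_sum DERIV_mult F assms(1))
  then show ?thesis
    by (simp add: mfun_altdef[OF N] mfun_altdef[OF N'] sum.distrib mult.commute)
qed

text \<open>Point evaluation is the functional with geometric moments; a moment derivative
  \<open>- c t * t ^ k\<close> is thus a point mass at the jump.\<close>

lemma mfun_geometric: "mfun (\<lambda>i. c * x ^ i) f = c * poly f x"
  by (simp add: mfun_def poly_altdef sum_distrib_left mult_ac)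

text \<open>A case of \<open>mfun_has_deriv\<close>: evaluation at s is the functional with moments
  \<open>s ^ i\<close>.\<close>

lemma poly_family_has_deriv:
  assumes "poly_has_deriv F F' t"
  shows "((\<lambda>s. poly (F s) s) has_real_derivative poly F' t + poly (pderiv (F t)) t) (at t)"
proof -
  define m' where "m' = (\<lambda>i. real i * t ^ (i - 1))"
  have pow: "((\<lambda>s. s ^ i) has_real_derivative m' i) (at t)" for i
    unfolding m'_def by (auto intro!: derivative_eq_intros)
  have eq: "mfun (\<lambda>i. s ^ i) f = poly f s" for f s
    using mfun_geometric[of 1] by simp
  have "mfun m' f = poly (pderiv f) t" for f
    using mfun_has_deriv[of "\<lambda>s i. s ^ i" m', OF pow poly_has_deriv_const[of f t]]
    unfolding eq by (auto intro: DERIV_unique poly_DERIV)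
  then show ?thesis
    using mfun_has_deriv[of "\<lambda>s i. s ^ i" m', OF pow assms] by (simp add: eq)
qed

section \<open>Ladder operators\<close>

text \<open>\<open>pCons 0 (pderiv f)\<close> is the Euler operator x d/dx, diagonal on
  monomials.\<close>

lemma coeff_pCons_0_pderiv: "coeff (pCons 0 (pderiv f)) i = of_nat i * coeff f i"
  by (cases i) (auto simp: coeff_pderiv)

lemma pCons_0_pderiv_mult:
  "pCons 0 (pderiv (f * g)) = pCons 0 (pderiv f) * g + pCons 0 (pderiv g) * f"
  by (simp add: pderiv_mult algebra_simps)

text \<open>For the jump weight, \<open>c t\<close> is \<open>B t\<^sup>\<alpha> e\<^sup>-\<^sup>t\<close>.\<close>

locale jump_moments =
  fixes \<alpha> :: real and c :: "real \<Rightarrow> real" and m :: "real \<Rightarrow> nat \<Rightarrow> real"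
  assumes pos: "t > 0 \<Longrightarrow> pos_functional (m t)"
    and m_deriv: "t > 0 \<Longrightarrow> ((\<lambda>s. m s k) has_real_derivative - c t * t ^ k) (at t)"
    and m_rec: "t > 0 \<Longrightarrow> m t (Suc k) = (real k + 1 + \<alpha>) * m t k + c t * t ^ Suc k"
    and c_deriv: "t > 0 \<Longrightarrow> (c has_real_derivative (\<alpha> - t) / t * c t) (at t)"
begin

section \<open>Variation of the functional and of the polynomials with the parameter\<close>

abbreviation "p n t \<equiv> poly (mop (m t) n) t"

lemma mfun_family_has_deriv:
  assumes "t > 0" "poly_has_deriv F F' t"
  shows "((\<lambda>s. mfun (m s) (F s)) has_real_derivative mfun (m t) F' - c t * poly (F t) t) (at t)"
  using mfun_has_deriv[of m "\<lambda>k. - c t * t ^ k", OF m_deriv[OF assms(1)] assms(2)] mfun_geometric[of "- c t" t "F t"] by simp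

text \<open>The integrated form of the Pearson equation: integration by parts against the weight,
  done on moments via \<open>m_rec\<close>, with the jump contributing the right-hand side.\<close>

lemma mfun_euler:
  assumes "t > 0"
  shows "mfun (m t) (pCons 0 (pderiv f)) + (1 + \<alpha>) * mfun (m t) f - mfun (m t) (pCons 0 f)
    = - (t * c t * poly f t)"
proof -
  define N where "N = degree f"
  have "degree (pCons 0 (pderiv f)) \<le> N"
    by (auto simp: degree_pCons_eq_if N_def degree_pderiv pderiv_eq_0_iff)
  then have 1: "mfun (m t) (pCons 0 (pderiv f)) = (\<Sum>i\<le>N. real i * coeff f i * m t i)"
    by (simp add: mfun_altdef[of _ N] coeff_pCons_0_pderiv)
  have "mfun (m t) (pCons 0 f) = (\<Sum>i\<le>Suc N. coeff (pCons 0 f) i * m t i)"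
    by (rule mfun_altdef) (simp add: N_def degree_pCons_eq_if)
  also have "\<dots> = (\<Sum>i\<le>N. coeff f i * m t (Suc i))"
    by (subst sum.atMost_Suc_shift) simp
  finally have 2: "mfun (m t) (pCons 0 f) = (\<Sum>i\<le>N. coeff f i * m t (Suc i))" .
  have "mfun (m t) (pCons 0 (pderiv f)) + (1 + \<alpha>) * mfun (m t) f - mfun (m t) (pCons 0 f)
     = (\<Sum>i\<le>N. - (coeff f i * (c t * t ^ Suc i)))"
    unfolding 1 2 mfun_altdef[OF eq_refl[OF N_def[symmetric]]] m_rec[OF assms]
    by (simp add: sum_distrib_left flip: sum.distrib sum_subtractf) (simp add: algebra_simps)
  also have "\<dots> = - (t * c t * poly f t)"
    by (simp add: poly_altdef N_def sum_distrib_left sum_negf mult_ac)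
  finally show ?thesis .
qed

text \<open>The recurrence preserves differentiability, since positivity keeps the divisors nonzero.
  Existence suffices here; orthogonality determines the derivative later.\<close>

lemma mop_has_deriv_ex: "t > 0 \<Longrightarrow> \<exists>F'. poly_has_deriv (\<lambda>s. mop (m s) n) F' t"
proof (induction n rule: less_induct)
  case (less n)
  interpret T: pos_functional "m t" using pos less.prems .
  show ?case
  proof (cases n)
    case 0
    then show ?thesis using poly_has_deriv_const[of 1 t] by auto
  next
    case (Suc k)
    obtain F G where F: "poly_has_deriv (\<lambda>s. mop (m s) k) F t"
      and G: "poly_has_deriv (\<lambda>s. mop (m s) (k - 1)) G t"
      using less.IH[of k] less.IH[of "k - 1"] less.prems Suc by (auto simp: less_Suc_eq_le)
    note D = mfun_family_has_deriv[OF less.prems]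
    have hk: "\<exists>d. ((\<lambda>s. mnorm (m s) k) has_real_derivative d) (at t)"
      unfolding mnorm_def using D[OF poly_has_deriv_mult[OF F F]] by blast
    have "\<exists>d. ((\<lambda>s. mfun (m s) (pCons 0 (mop (m s) k * mop (m s) k))) has_real_derivative d) (at t)"
      using D[OF poly_has_deriv_pCons_0[OF poly_has_deriv_mult[OF F F]]] by blast
    then obtain a where a: "((\<lambda>s. rec_a (m s) k) has_real_derivative a) (at t)"
      unfolding rec_a_def using hk DERIV_divide T.h_nonzero by blast
    have "\<exists>d. ((\<lambda>s. mnorm (m s) (k - 1)) has_real_derivative d) (at t)"
      unfolding mnorm_def using D[OF poly_has_deriv_mult[OF G G]] by blast
    then have "\<exists>d. ((\<lambda>s. mnorm (m s) k / mnorm (m s) (k - 1)) has_real_derivative d) (at t)"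
      using hk DERIV_divide T.h_nonzero by blast
    then have "\<exists>b. ((\<lambda>s. rec_b (m s) k) has_real_derivative b) (at t)"
      by (cases "k = 0") (auto simp: rec_b_def intro: exI[of _ 0])
    then obtain b where b: "((\<lambda>s. rec_b (m s) k) has_real_derivative b) (at t)" ..
    show ?thesis
      unfolding Suc mop_Suc
      using poly_has_deriv_diff[OF poly_has_deriv_diff[OF poly_has_deriv_pCons_0[OF F]
        poly_has_deriv_smult[OF a F]] poly_has_deriv_smult[OF b G]] by blast
  qed
qed

definition dmop :: "nat \<Rightarrow> real \<Rightarrow> real poly" where
  "dmop n t = (SOME F'. poly_has_deriv (\<lambda>s. mop (m s) n) F' t)"

lemma mop_has_deriv: "t > 0 \<Longrightarrow> poly_has_deriv (\<lambda>s. mop (m s) n) (dmop n t) t"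
  unfolding dmop_def by (rule someI_ex) (rule mop_has_deriv_ex)

lemma coeff_mop_has_deriv:
  "t > 0 \<Longrightarrow> ((\<lambda>s. coeff (mop (m s) n) i) has_real_derivative coeff (dmop n t) i) (at t)"
  using mop_has_deriv[of t n] by (simp add: poly_has_deriv_def)

text \<open>The leading coefficient is constantly 1, so differentiation in t lowers the degree; this
  makes orthogonality applicable to \<open>dmop\<close>.\<close>

lemma coeff_dmop_eq_0:
  assumes "t > 0" "n \<le> i"
  shows "coeff (dmop n t) i = 0"
proof -
  have "(\<lambda>s. coeff (mop (m s) n) i) = (\<lambda>s. if i = n then 1 else 0)"
    using assms(2) by (auto simp: coeff_mop_eq_0)
  then show ?thesis
    using DERIV_unique[OF coeff_mop_has_deriv[OF assms(1), of n i], of 0] by simp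
qed

text \<open>Variation of the polynomial drops out by orthogonality; only the point mass at t
  remains.\<close>

lemma mnorm_has_deriv:
  assumes "t > 0"
  shows "((\<lambda>s. mnorm (m s) n) has_real_derivative - c t * (p n t)\<^sup>2) (at t)"
proof -
  interpret T: pos_functional "m t" using pos assms .
  have "mfun (m t) (dmop n t * mop (m t) n) = 0"
    by (rule T.mop_orthogonal_lower) (simp add: coeff_dmop_eq_0 assms)
  then have "mfun (m t) (dmop n t * mop (m t) n) = 0" "mfun (m t) (mop (m t) n * dmop n t) = 0"
    by (simp_all add: mult.commute)
  then show ?thesis
    using mfun_family_has_deriv[OF assms poly_has_deriv_mult[OF mop_has_deriv mop_has_deriv], OF assms assms, of n n]
    unfolding mnorm_def mfun_add by (simp add: power2_eq_square)
qed

text \<open>Differentiate the orthogonality relation in t; the variation of the lower polynomial is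
  orthogonal to the higher one.\<close>

lemma mfun_dmop_mop:
  assumes "t > 0" "j < n"
  shows "mfun (m t) (dmop n t * mop (m t) j) = c t * p n t * p j t"
proof -
  interpret T: pos_functional "m t" using pos assms(1) .
  have "mfun (m t) (mop (m t) n * dmop j t) = 0"
    using T.mop_orthogonal_lower[of n "dmop j t"] assms by (simp add: coeff_dmop_eq_0 mult.commute)
  then have "((\<lambda>s. mfun (m s) (mop (m s) n * mop (m s) j)) has_real_derivative
      mfun (m t) (dmop n t * mop (m t) j) - c t * p n t * p j t) (at t)"
    using mfun_family_has_deriv[OF assms(1) poly_has_deriv_mult[OF mop_has_deriv mop_has_deriv], OF assms(1) assms(1), of n j]
    by (simp add: mfun_linear mult.assoc)
  moreover have "((\<lambda>s. mfun (m s) (mop (m s) n * mop (m s) j)) has_real_derivative 0) (at t)"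
  proof (rule has_field_derivative_transform_within_open[of "\<lambda>_. 0" 0 t "{0<..}"])
    fix s :: real assume "s \<in> {0<..}"
    then interpret S: pos_functional "m s" using pos by simp
    show "0 = mfun (m s) (mop (m s) n * mop (m s) j)"
      using S.mop_orthogonal assms(2) by simp
  qed (use assms in auto)
  ultimately show ?thesis
    using DERIV_unique by fastforce
qed

lemma poly_dmop:
  assumes "t > 0"
  shows "poly (dmop n t) t = c t * p n t * (\<Sum>j<n. (p j t)\<^sup>2 / mnorm (m t) j)"
proof -
  interpret T: pos_functional "m t" using pos assms .
  have "dmop n t = (\<Sum>j<n. smult (c t * p n t * p j t / mnorm (m t) j) (mop (m t) j))"
    using T.mop_expansion[of n "dmop n t"] assms by (simp add: coeff_dmop_eq_0 mfun_dmop_mop)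
  then have "poly (dmop n t) t = poly (\<Sum>j<n. smult (c t * p n t * p j t / mnorm (m t) j) (mop (m t) j)) t"
    by simp
  then show ?thesis
    by (simp add: poly_sum sum_distrib_left power2_eq_square mult_ac)
qed

lemma coeff_dmop_subleading:
  assumes "t > 0"
  shows "coeff (dmop (Suc k) t) k = c t * p (Suc k) t * p k t / mnorm (m t) k"
proof -
  interpret T: pos_functional "m t" using pos assms .
  have "mfun (m t) (dmop (Suc k) t * mop (m t) k) = coeff (dmop (Suc k) t) k * mnorm (m t) k"
    by (rule T.mfun_mult_mop) (simp add: coeff_dmop_eq_0 assms)
  then show ?thesis
    using mfun_dmop_mop[OF assms, of k "Suc k"] by (simp add: field_simps)
qed

section \<open>The recurrence coefficient and the ladder equation\<close>

lemma rec_a_eq: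
  assumes "t > 0"
  shows "rec_a (m t) n = 2 * real n + 1 + \<alpha> + t * c t * (p n t)\<^sup>2 / mnorm (m t) n"
proof -
  interpret T: pos_functional "m t" using pos assms .
  let ?P = "mop (m t) n"
  \<comment> \<open>The Euler operator multiplies the leading coefficient by n, and all lower terms
    are orthogonal to \<open>?P\<close>.\<close>
  have "mfun (m t) (pCons 0 (pderiv ?P) * ?P) = real n * mnorm (m t) n"
    by (subst T.mfun_mult_mop) (auto simp only: coeff_pCons_0_pderiv coeff_mop_self, simp add: coeff_mop_eq_0)
  then have "mfun (m t) (pCons 0 (pderiv (?P * ?P))) = 2 * real n * mnorm (m t) n"
    unfolding pCons_0_pderiv_mult mfun_add by simp
  then have "2 * real n * mnorm (m t) n + (1 + \<alpha>) * mnorm (m t) n - rec_a (m t) n * mnorm (m t) n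
      = - (t * c t * (p n t)\<^sup>2)"
    using mfun_euler[OF assms, of "?P * ?P"] unfolding T.rec_a_h by (simp add: mnorm_def power2_eq_square)
  then have "rec_a (m t) n * mnorm (m t) n = (2 * real n + 1 + \<alpha>) * mnorm (m t) n + t * c t * (p n t)\<^sup>2"
    by (simp add: algebra_simps)
  then show ?thesis
    by (simp add: field_simps)
qed

text \<open>Moving the multiple by n to the left leaves a polynomial of degree below n; its pairings
  with the lower polynomials are those of x times \<open>mop (m t) n\<close>, and only the one at n
  - 1 is nonzero.\<close>

lemma mop_ladder:
  assumes "t > 0"
  shows "pCons 0 (pderiv (mop (m t) n)) + smult t (dmop n t)
    = smult (real n) (mop (m t) n) + smult (rec_b (m t) n) (mop (m t) (n - 1))"
proof -
  interpret T: pos_functional "m t" using pos assms .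
  let ?P = "mop (m t)"
  define f where "f = pCons 0 (pderiv (?P n)) + smult t (dmop n t) - smult (real n) (?P n)"
  have f0: "coeff f i = 0" if "n \<le> i" for i
    using that by (cases "i = n")
      (auto simp: f_def coeff_pCons_0_pderiv coeff_dmop_eq_0 assms coeff_mop_eq_0 simp del: coeff_pCons)
  have fP: "mfun (m t) (f * ?P j) = mfun (m t) (pCons 0 (?P n * ?P j))" if j: "j < n" for j
  proof -
    have "mfun (m t) (pCons 0 (pderiv (?P j)) * ?P n) = 0"
      by (rule T.mop_orthogonal_lower) (use j in \<open>auto simp only: coeff_pCons_0_pderiv, auto simp: coeff_mop_eq_0\<close>)
    then have "mfun (m t) (pCons 0 (pderiv (?P n * ?P j))) = mfun (m t) (pCons 0 (pderiv (?P n)) * ?P j)"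
      unfolding pCons_0_pderiv_mult mfun_add by simp
    then have "mfun (m t) (pCons 0 (pderiv (?P n)) * ?P j) - mfun (m t) (pCons 0 (?P n * ?P j))
        = - (t * c t * p n t * p j t)"
      using mfun_euler[OF assms, of "?P n * ?P j"] T.mop_orthogonal[OF j] by (simp add: mult.assoc)
    \<comment> \<open>The jump term cancels against the pairing of \<open>smult t (dmop n t)\<close>
      with \<open>?P j\<close>.\<close>
    then show ?thesis
      unfolding f_def left_diff_distrib distrib_right mult_smult_left mfun_linear
        mfun_dmop_mop[OF assms j] T.mop_orthogonal[OF j] by (simp add: mult_ac)
  qed
  have "f = smult (rec_b (m t) n) (?P (n - 1))"
  proof (cases n)
    case 0
    then show ?thesis using f0 by (simp add: rec_b_def poly_eq_iff)
  next
    case (Suc k)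
    have xP: "mfun (m t) (pCons 0 (?P n * ?P j)) = (if j = k then mnorm (m t) n else 0)" if j: "j < n" for j
    proof -
      have "mfun (m t) (pCons 0 (?P j) * ?P n) = coeff (pCons 0 (?P j)) n * mnorm (m t) n"
        by (rule T.mfun_mult_mop) (use j in \<open>auto simp: coeff_pCons coeff_mop_eq_0 split: nat.splits\<close>)
      then show ?thesis
        using j Suc by (auto simp: mult.commute coeff_mop_eq_0)
    qed
    have b: "rec_b (m t) n = mnorm (m t) n / mnorm (m t) k" "n - Suc 0 = k"
      by (simp_all add: Suc rec_b_def)
    have "f = (\<Sum>j<n. smult (mfun (m t) (f * ?P j) / mnorm (m t) j) (?P j))"
      by (rule T.mop_expansion) (rule f0)
    also have "\<dots> = (\<Sum>j<n. if j = k then smult (rec_b (m t) n) (?P (n - 1)) else 0)"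
      by (intro sum.cong refl) (auto simp: fP xP b)
    also have "\<dots> = smult (rec_b (m t) n) (?P (n - 1))"
      by (simp add: Suc)
    finally show ?thesis .
  qed
  then show ?thesis
    by (simp add: f_def algebra_simps)
qed

section \<open>The Christoffel-Darboux kernel on the diagonal and the derivatives of H\<close>

definition kernel :: "nat \<Rightarrow> real \<Rightarrow> real" where
  "kernel n t = (\<Sum>j<n. (p j t)\<^sup>2 / mnorm (m t) j)"

lemma ln_hankel_has_deriv:
  assumes "t > 0"
  shows "((\<lambda>s. ln (det (mat n n (\<lambda>(i, j). m s (i + j))))) has_real_derivative - c t * kernel n t) (at t)"
proof (rule has_field_derivative_transform_within_open[of "\<lambda>s. \<Sum>j<n. ln (mnorm (m s) j)" _ t "{0<..}"])
  interpret T: pos_functional "m t" using pos assms .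
  have "((\<lambda>s. \<Sum>j<n. ln (mnorm (m s) j)) has_real_derivative
      (\<Sum>j<n. 1 / mnorm (m t) j * (- c t * (p j t)\<^sup>2))) (at t)"
    by (rule DERIV_sum, rule DERIV_chain2[OF DERIV_ln_divide mnorm_has_deriv]) (use assms T.h_pos in auto)
  then show "((\<lambda>s. \<Sum>j<n. ln (mnorm (m s) j)) has_real_derivative - c t * kernel n t) (at t)"
    by (simp add: kernel_def sum_distrib_left)
next
  fix s :: real assume "s \<in> {0<..}"
  then interpret S: pos_functional "m s" using pos by simp
  show "(\<Sum>j<n. ln (mnorm (m s) j)) = ln (det (mat n n (\<lambda>(i, j). m s (i + j))))"
    unfolding S.hankel_det using S.h_pos by (subst ln_prod) (auto simp: less_imp_neq)
qed (use assms in auto)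

text \<open>Sum the closed form of \<open>rec_a\<close>: the arithmetic progression gives n (n +
  \<alpha>) with n = \<open>Suc k\<close>, the jump terms give the kernel. H thus becomes a
  coefficient plus a constant, which is easy to differentiate.\<close>

lemma mop_subleading_kernel:
  assumes "t > 0"
  shows "coeff (mop (m t) (Suc k)) k
    = - (t * c t * kernel (Suc k) t) - real (Suc k) * (real (Suc k) + \<alpha>)"
proof -
  have "(\<Sum>j\<le>k. 2 * real j + 1 + \<alpha>) = real (Suc k) * (real (Suc k) + \<alpha>)"
    by (induction k) (auto simp: algebra_simps)
  moreover have "(\<Sum>j\<le>k. rec_a (m t) j) = (\<Sum>j\<le>k. 2 * real j + 1 + \<alpha>) + t * c t * kernel (Suc k) t"
    by (simp add: rec_a_eq[OF assms] kernel_def sum.distrib sum_distrib_left lessThan_Suc_atMost del: sum.lessThan_Suc)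
  ultimately show ?thesis
    by (simp add: coeff_mop_subleading)
qed

text \<open>At x = t both the argument and the polynomial move; the ladder equation evaluated at t
  gives t times the sum of the two derivatives.\<close>

lemma p_has_deriv:
  assumes "t > 0"
  shows "(p n has_real_derivative (real n * p n t + rec_b (m t) n * p (n - 1) t) / t) (at t)"
proof -
  have "t * (poly (dmop n t) t + poly (pderiv (mop (m t) n)) t) = real n * p n t + rec_b (m t) n * p (n - 1) t"
    using arg_cong[OF mop_ladder[OF assms, of n], of "\<lambda>f. poly f t"] by (simp add: algebra_simps)
  then have "poly (dmop n t) t + poly (pderiv (mop (m t) n)) t = (real n * p n t + rec_b (m t) n * p (n - 1) t) / t"
    using assms by (simp add: field_simps)
  then show ?thesis
    using poly_family_has_deriv[OF mop_has_deriv[OF assms, of n]] by simp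
qed

text \<open>H' in closed form for n = \<open>Suc k\<close>; this index keeps n - 1 free of
  truncation.\<close>

definition H_deriv :: "nat \<Rightarrow> real \<Rightarrow> real" where
  "H_deriv k t = c t * p (Suc k) t * p k t / mnorm (m t) k"

lemma neg_kernel_has_deriv:
  assumes "t > 0"
  shows "((\<lambda>s. - (s * c s * kernel (Suc k) s)) has_real_derivative H_deriv k t) (at t)"
proof (rule has_field_derivative_transform_within_open
    [of "\<lambda>s. coeff (mop (m s) (Suc k)) k + real (Suc k) * (real (Suc k) + \<alpha>)" _ t "{0<..}"])
  show "((\<lambda>s. coeff (mop (m s) (Suc k)) k + real (Suc k) * (real (Suc k) + \<alpha>))
      has_real_derivative H_deriv k t) (at t)"
    using DERIV_add[OF coeff_mop_has_deriv[OF assms, of "Suc k" k] DERIV_const]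
    by (simp add: coeff_dmop_subleading[OF assms] H_deriv_def)
qed (use assms in \<open>auto simp: mop_subleading_kernel\<close>)

lemma H_deriv_has_deriv:
  assumes "t > 0"
  shows "(H_deriv k has_real_derivative
    c t * (rec_b (m t) (Suc k) * (p k t)\<^sup>2 - (p (Suc k) t)\<^sup>2) / mnorm (m t) k / t) (at t)"
proof -
  interpret T: pos_functional "m t" using pos assms .
  define g b x y where "g = mnorm (m t) k" and "b = rec_b (m t) (Suc k)" and "x = p (Suc k) t" and "y = p k t"
  have g: "g > 0" unfolding g_def by (rule T.h_pos)
  have dx: "(p (Suc k) has_real_derivative (real (Suc k) * x + b * y) / t) (at t)"
    using p_has_deriv[OF assms, of "Suc k"] by (simp add: b_def x_def y_def)
  have "rec_b (m t) k * p (k - 1) t = (t - rec_a (m t) k) * y - x"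
    by (simp add: x_def y_def poly_mop_Suc)
  also have "rec_a (m t) k = 2 * real k + 1 + \<alpha> + t * c t * y\<^sup>2 / g"
    using rec_a_eq[OF assms] by (simp add: y_def g_def)
  finally have dy: "(p k has_real_derivative
      (real k * y + ((t - (2 * real k + 1 + \<alpha> + t * c t * y\<^sup>2 / g)) * y - x)) / t) (at t)"
    using p_has_deriv[OF assms, of k] by (simp add: y_def)
  have dg: "((\<lambda>s. mnorm (m s) k) has_real_derivative - c t * y\<^sup>2) (at t)"
    using mnorm_has_deriv[OF assms] by (simp add: y_def)
  note D = DERIV_divide[OF DERIV_mult[OF DERIV_mult[OF c_deriv[OF assms] dx] dy] dg T.h_nonzero]
  have "H_deriv k = (\<lambda>s. c s * p (Suc k) s * p k s / mnorm (m s) k)"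
    by (simp add: fun_eq_iff H_deriv_def)
  \<comment> \<open>The x y terms cancel since (\<alpha> - t) + (k + 1) + k + (t - 2 k - 1 -
    \<alpha>) = 0, and the term from the norm cancels the one with t c y^2 / g.\<close>
  moreover have "((((\<alpha> - t) / t * c t * x + (real (Suc k) * x + b * y) / t * c t) * y
      + (real k * y + ((t - (2 * real k + 1 + \<alpha> + t * c t * y\<^sup>2 / g)) * y - x)) / t * (c t * x)) * g
      - c t * x * y * (- c t * y\<^sup>2)) / (g * g) = c t * (b * y\<^sup>2 - x\<^sup>2) / g / t"
    using assms g by (simp add: field_simps power2_eq_square)
  ultimately show ?thesis
    using D unfolding g_def[symmetric] b_def[symmetric] x_def[symmetric] y_def[symmetric] by simp
qed

text \<open>Compare coefficients of degree k in the ladder equation for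
  \<open>Suc k\<close>.\<close>

lemma rec_b_eq:
  assumes "t > 0"
  shows "rec_b (m t) (Suc k)
    = t * H_deriv k t + t * c t * kernel (Suc k) t + real (Suc k) * (real (Suc k) + \<alpha>)"
proof -
  have "real k * coeff (mop (m t) (Suc k)) k + t * H_deriv k t
      = real (Suc k) * coeff (mop (m t) (Suc k)) k + rec_b (m t) (Suc k)"
    using arg_cong[OF mop_ladder[OF assms, of "Suc k"], of "\<lambda>f. coeff f k"]
    by (simp add: coeff_pCons_0_pderiv coeff_dmop_subleading[OF assms] H_deriv_def)
  then have "rec_b (m t) (Suc k) = t * H_deriv k t - coeff (mop (m t) (Suc k)) k"
    by (simp add: algebra_simps)
  then show ?thesis
    by (simp add: mop_subleading_kernel[OF assms])
qed

text \<open>Christoffel-Darboux in its confluent form, with both x-derivatives eliminated by the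
  ladder equation.\<close>

lemma sum_squares_eq:
  assumes "t > 0"
  shows "c t * (rec_b (m t) (Suc k) * (p k t)\<^sup>2 + (p (Suc k) t)\<^sup>2) / mnorm (m t) k
    = t * c t * kernel (Suc k) t - (2 * real (Suc k) + \<alpha> - t) * H_deriv k t"
proof -
  interpret T: pos_functional "m t" using pos assms .
  define g b x y K where "g = mnorm (m t) k" and "b = rec_b (m t) (Suc k)" and "x = p (Suc k) t"
    and "y = p k t" and "K = kernel (Suc k) t"
  define x' y' where "x' = poly (pderiv (mop (m t) (Suc k))) t" and "y' = poly (pderiv (mop (m t) k)) t"
  have g: "g > 0" unfolding g_def by (rule T.h_pos)
  \<comment> \<open>The ladder equations involve the kernels of orders k + 1 and k; expressed by the
    same \<open>K\<close>, these terms cancel in the Christoffel-Darboux combination.\<close>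
  have Kk: "kernel k t = K - y\<^sup>2 / g"
    by (simp add: K_def kernel_def y_def g_def)
  have ladder: "t * poly (pderiv (mop (m t) n)) t + t * (c t * p n t * kernel n t)
      = real n * p n t + rec_b (m t) n * p (n - 1) t" for n
    using arg_cong[OF mop_ladder[OF assms, of n], of "\<lambda>f. poly f t"]
    by (simp add: poly_dmop[OF assms] kernel_def)
  have x': "t * x' = real (Suc k) * x + b * y - t * c t * x * K"
    using ladder[of "Suc k"] by (simp add: x'_def x_def y_def b_def K_def algebra_simps)
  have "rec_b (m t) k * p (k - 1) t = (t - rec_a (m t) k) * y - x"
    by (simp add: x_def y_def poly_mop_Suc)
  also have "rec_a (m t) k = 2 * real k + 1 + \<alpha> + t * c t * y\<^sup>2 / g"
    using rec_a_eq[OF assms] by (simp add: y_def g_def)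
  finally have y': "t * y' = real k * y + (t - (2 * real k + 1 + \<alpha>)) * y - x - t * c t * y * K"
    using ladder[of k] unfolding Kk y_def[symmetric] y'_def[symmetric]
    by (simp add: algebra_simps power2_eq_square)
  have "g * K = x' * y - x * y'"
    using T.christoffel_darboux_confluent[of k t]
    by (simp add: g_def K_def kernel_def x'_def y'_def x_def y_def lessThan_Suc_atMost del: sum.lessThan_Suc)
  then have "t * (g * K) = (t * x') * y - x * (t * y')"
    by (simp add: right_diff_distrib mult_ac)
  also have "\<dots> = b * y\<^sup>2 + x\<^sup>2 + (2 * real (Suc k) + \<alpha> - t) * (x * y)"
    unfolding x' y' by (simp add: algebra_simps power2_eq_square)
  finally have "b * y\<^sup>2 + x\<^sup>2 = t * (g * K) - (2 * real (Suc k) + \<alpha> - t) * (x * y)" by simp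
  then have "c t * (b * y\<^sup>2 + x\<^sup>2) / g = c t * (t * (g * K) - (2 * real (Suc k) + \<alpha> - t) * (x * y)) / g"
    by (simp only:)
  also have "\<dots> = t * c t * K - (2 * real (Suc k) + \<alpha> - t) * (c t * x * y / g)"
    using g by (simp add: field_simps)
  finally show ?thesis
    by (simp add: H_deriv_def g_def b_def x_def y_def K_def)
qed

text \<open>Agreement on the positive half-line suffices, because both derivatives at t are
  local.\<close>

lemma sigma_form:
  fixes H :: "real \<Rightarrow> real"
  assumes t: "t > 0" and H: "\<And>s. s > 0 \<Longrightarrow> H s = - (s * c s * kernel (Suc k) s)"
  defines "n \<equiv> real (Suc k)"
  shows "H differentiable (at t) \<and> deriv H differentiable (at t) \<and>
    (t * deriv (deriv H) t)\<^sup>2 = 4 * (deriv H t)\<^sup>2 * (H t - n * (n + \<alpha>) - t * deriv H t)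
      + ((2 * n + \<alpha> - t) * deriv H t + H t)\<^sup>2"
proof -
  define R where "R = c t * (rec_b (m t) (Suc k) * (p k t)\<^sup>2 - (p (Suc k) t)\<^sup>2) / mnorm (m t) k"
  have dH: "(H has_real_derivative H_deriv k s) (at s)" if "s > 0" for s
    by (rule has_field_derivative_transform_within_open[OF neg_kernel_has_deriv, of s "{0<..}"])
      (use that H in auto)
  then have derivH: "deriv H s = H_deriv k s" if "s > 0" for s
    using that DERIV_imp_deriv by blast
  have dr: "(deriv H has_real_derivative R / t) (at t)"
    by (rule has_field_derivative_transform_within_open[OF H_deriv_has_deriv[OF t, of k, folded R_def], of "{0<..}"])
      (use t derivH in auto)
  have b: "rec_b (m t) (Suc k) = n * (n + \<alpha>) - H t + t * H_deriv k t"
    using rec_b_eq[OF t] by (simp add: H[OF t] n_def)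
  have S: "c t * (rec_b (m t) (Suc k) * (p k t)\<^sup>2 + (p (Suc k) t)\<^sup>2) / mnorm (m t) k
      = - ((2 * n + \<alpha> - t) * H_deriv k t + H t)" (is "?S = _")
    using sum_squares_eq[OF t, of k] by (simp add: H[OF t] n_def)
  \<comment> \<open>With the values of u, x and y inserted next, \<open>u * x * y\<close> is
    \<open>H_deriv k t\<close>.\<close>
  have "(u * (b * y\<^sup>2 - x\<^sup>2))\<^sup>2 = (u * (b * y\<^sup>2 + x\<^sup>2))\<^sup>2 - 4 * b * (u * x * y)\<^sup>2" for u b x y :: real
    by (simp add: algebra_simps power2_eq_square)
  from this[of "c t / mnorm (m t) k" "rec_b (m t) (Suc k)" "p k t" "p (Suc k) t"]
  have "R\<^sup>2 = ?S\<^sup>2 - 4 * rec_b (m t) (Suc k) * (H_deriv k t)\<^sup>2"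
    by (simp add: R_def H_deriv_def)
  also have "\<dots> = 4 * (H_deriv k t)\<^sup>2 * (H t - n * (n + \<alpha>) - t * H_deriv k t)
      + ((2 * n + \<alpha> - t) * H_deriv k t + H t)\<^sup>2"
    unfolding S power2_minus unfolding b by (simp add: algebra_simps)
  finally have "R\<^sup>2 = \<dots>" .
  moreover have "t * deriv (deriv H) t = R"
    using DERIV_imp_deriv[OF dr] t by simp
  moreover have "H differentiable (at t)" "deriv H differentiable (at t)"
    using dH[OF t] dr real_differentiable_def by blast+
  ultimately show ?thesis
    by (simp add: derivH[OF t])
qed

end

section \<open>The Laguerre weight with a jump\<close>

lemma laguerre_has_integral:
  assumes "\<alpha> > 0"
  shows "((\<lambda>x. x ^ k * (x powr \<alpha> * exp (- x))) has_integral Gamma (real k + \<alpha> + 1)) {0..}"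
proof (rule has_integral_eq[OF _ Gamma_integral_real[of "real k + \<alpha> + 1"]])
  fix x :: real assume "x \<in> {0..}"
  then show "x powr (real k + \<alpha> + 1 - 1) / exp x = x ^ k * (x powr \<alpha> * exp (- x))"
    by (cases "x = 0") (auto simp: powr_add powr_realpow exp_minus field_simps)
qed (use assms in auto)

lemma laguerre_continuous:
  assumes "\<alpha> > (0 :: real)"
  shows "continuous_on {0..} (\<lambda>x. x ^ k * (x powr \<alpha> * exp (- x)))"
  using assms by (intro continuous_intros continuous_on_powr') auto

text \<open>On the half-line the jump factor equals A + B minus B times the indicator of [0, t], so
  t enters only through an integral over a compact interval.\<close>

lemma moment_has_integral:
  assumes "\<alpha> > 0" "t > 0"
  shows "((\<lambda>x. x ^ k * wt \<alpha> A B t x) has_integral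
    (A + B) * Gamma (real k + \<alpha> + 1) - B * integral {0..t} (\<lambda>x. x ^ k * (x powr \<alpha> * exp (- x)))) {0..}"
proof -
  define f where "f = (\<lambda>x::real. x ^ k * (x powr \<alpha> * exp (- x)))"
  have f: "(f has_integral Gamma (real k + \<alpha> + 1)) {0..}"
    unfolding f_def by (rule laguerre_has_integral) fact
  have "continuous_on {0..t} f"
    unfolding f_def by (rule continuous_on_subset[OF laguerre_continuous]) (use assms in auto)
  then have "(f has_integral integral {0..t} f) {0..t}"
    by (intro integrable_integral integrable_continuous_real)
  \<comment> \<open>The closed interval fits, as \<open>heaviside 0\<close> is zero.\<close>
  then have "((\<lambda>x. if x \<in> {0..t} then f x else 0) has_integral integral {0..t} f) {0..}"
    by (subst has_integral_restrict) auto
  from has_integral_diff[OF has_integral_mult_right[OF f, of "A + B"] has_integral_mult_right[OF this, of B]]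
  show ?thesis
    unfolding f_def[symmetric]
    by (rule has_integral_eq[rotated]) (auto simp: f_def wt_def heaviside_def algebra_simps)
qed

lemma moment_eq:
  assumes "\<alpha> > 0" "t > 0"
  shows "moment \<alpha> A B t k = (A + B) * Gamma (real k + \<alpha> + 1)
    - B * integral {0..t} (\<lambda>x. x ^ k * (x powr \<alpha> * exp (- x)))"
  unfolding moment_def by (rule integral_unique[OF moment_has_integral[OF assms]])

lemma moment_has_deriv:
  assumes "\<alpha> > 0" "t > 0"
  shows "((\<lambda>s. moment \<alpha> A B s k) has_real_derivative - (B * t powr \<alpha> * exp (- t)) * t ^ k) (at t)"
proof -
  define f where "f = (\<lambda>x::real. x ^ k * (x powr \<alpha> * exp (- x)))"
  \<comment> \<open>The interval extends beyond t, so that t is interior and the derivative is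
    two-sided.\<close>
  have "continuous_on {0..t + 1} f"
    unfolding f_def by (rule continuous_on_subset[OF laguerre_continuous]) (use assms in auto)
  from integral_has_real_derivative[OF this, of t]
  have "((\<lambda>s. integral {0..s} f) has_real_derivative f t) (at t)"
    using assms by (simp add: at_within_Icc_at)
  from DERIV_diff[OF DERIV_const[of "(A + B) * Gamma (real k + \<alpha> + 1)"] DERIV_cmult[OF this, of B]]
  have "((\<lambda>s. (A + B) * Gamma (real k + \<alpha> + 1) - B * integral {0..s} f) has_real_derivative
      - (B * t powr \<alpha> * exp (- t)) * t ^ k) (at t)"
    by (simp add: f_def mult_ac)
  then show ?thesis
    by (rule has_field_derivative_transform_within_open[of _ _ _ "{0<..}"])
      (use assms in \<open>auto simp: moment_eq f_def\<close>)
qed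

text \<open>The Gamma recurrence handles the full integral, integration by parts on [0, t] the
  truncated one, whose boundary term is the jump.\<close>

lemma moment_Suc:
  assumes "\<alpha> > 0" "t > 0"
  shows "moment \<alpha> A B t (Suc k)
    = (real k + 1 + \<alpha>) * moment \<alpha> A B t k + B * t powr \<alpha> * exp (- t) * t ^ Suc k"
proof -
  define f where "f = (\<lambda>k (x::real). x ^ k * (x powr \<alpha> * exp (- x)))"
  have cont: "continuous_on {0..t} (f k)" for k
    unfolding f_def by (rule continuous_on_subset[OF laguerre_continuous]) (use assms in auto)
  have boundary: "((\<lambda>x. (real k + 1 + \<alpha>) * f k x - f (Suc k) x) has_integral f (Suc k) t - f (Suc k) 0) {0..t}"
  proof (rule fundamental_theorem_of_calculus_interior)
    fix x assume x: "x \<in> {0<..<t}"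
    have pow: "k = 0 \<or> x * x ^ (k - Suc 0) = x ^ k"
      by (cases k) auto
    have "(f (Suc k) has_real_derivative (real k + 1 + \<alpha>) * f k x - f (Suc k) x) (at x)"
      unfolding f_def using x pow
      by (auto intro!: derivative_eq_intros simp: powr_diff field_simps)
    then show "(f (Suc k) has_vector_derivative (real k + 1 + \<alpha>) * f k x - f (Suc k) x) (at x)"
      by (simp add: has_real_derivative_iff_has_vector_derivative)
  qed (use assms cont in auto)
  have split: "((\<lambda>x. (real k + 1 + \<alpha>) * f k x - f (Suc k) x) has_integral
      (real k + 1 + \<alpha>) * integral {0..t} (f k) - integral {0..t} (f (Suc k))) {0..t}"
    by (intro has_integral_diff has_integral_mult_right integrable_integral integrable_continuous_real cont)
  have f0: "f (Suc k) 0 = 0"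
    by (simp add: f_def)
  have I: "integral {0..t} (f (Suc k)) = (real k + 1 + \<alpha>) * integral {0..t} (f k) - f (Suc k) t"
    using has_integral_unique[OF boundary split] f0 by linarith
  have G: "Gamma (real (Suc k) + \<alpha> + 1) = (real k + 1 + \<alpha>) * Gamma (real k + \<alpha> + 1)"
    using Gamma_plus1[of "real k + \<alpha> + 1"] nonpos_Ints_nonpos[of "real k + \<alpha> + 1"] assms
    by (force simp: add_ac)
  have "moment \<alpha> A B t j = (A + B) * Gamma (real j + \<alpha> + 1) - B * integral {0..t} (f j)" for j
    by (simp add: moment_eq[OF assms] f_def)
  then have "moment \<alpha> A B t (Suc k) = (real k + 1 + \<alpha>) * moment \<alpha> A B t k + B * f (Suc k) t"
    by (simp only: G I) (simp add: algebra_simps)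
  then show ?thesis
    by (simp add: f_def mult_ac)
qed

section \<open>Positivity of the moment functional\<close>

lemma mfun_moment_has_integral:
  assumes "\<alpha> > 0" "t > 0"
  shows "((\<lambda>x. poly f x * wt \<alpha> A B t x) has_integral mfun (moment \<alpha> A B t) f) {0..}"
proof -
  have "((\<lambda>x. \<Sum>i\<le>degree f. coeff f i * (x ^ i * wt \<alpha> A B t x)) has_integral
      (\<Sum>i\<le>degree f. coeff f i * moment \<alpha> A B t i)) {0..}"
    unfolding moment_eq[OF assms]
    by (intro has_integral_sum has_integral_mult_right moment_has_integral assms) auto
  then show ?thesis
    by (simp add: mfun_def poly_altdef sum_distrib_right mult.assoc)
qed

text \<open>The interval [t + 1, t + 2] avoids both 0 and the jump: there the weight is continuous
  and positive, and a nonzero polynomial cannot vanish on all of it.\<close>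

lemma pos_functional_moment:
  assumes "\<alpha> > 0" "A \<ge> 0" "B > 0" "t > 0"
  shows "pos_functional (moment \<alpha> A B t)"
proof
  fix f :: "real poly" assume f: "f \<noteq> 0"
  define F where "F = (\<lambda>x. poly (f * f) x * wt \<alpha> A B t x)"
  define G where "G = (\<lambda>x. poly (f * f) x * (x powr \<alpha> * exp (- x) * (A + B)))"
  have F: "(F has_integral mfun (moment \<alpha> A B t) (f * f)) {0..}"
    unfolding F_def using assms by (intro mfun_moment_has_integral) auto
  have nonneg: "F x \<ge> 0" for x
    using assms by (auto simp: F_def wt_def heaviside_def)
  have FG: "F x = G x" if "x \<in> {t + 1..t + 2}" for x
    using that by (auto simp: F_def G_def wt_def heaviside_def)
  have contG: "continuous_on {t + 1..t + 2} G"
    unfolding G_def using assms by (intro continuous_intros) auto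
  have "(G has_integral integral {t + 1..t + 2} G) {t + 1..t + 2}"
    by (intro integrable_integral integrable_continuous_real contG)
  then have FI: "(F has_integral integral {t + 1..t + 2} G) {t + 1..t + 2}"
    by (rule has_integral_eq[rotated]) (simp add: FG)
  have le: "integral {t + 1..t + 2} G \<le> mfun (moment \<alpha> A B t) (f * f)"
    by (rule has_integral_subset_le[OF _ FI F]) (use assms nonneg in auto)
  have "0 \<le> integral {t + 1..t + 2} G"
    by (rule has_integral_nonneg[OF FI]) (rule nonneg)
  moreover have "integral {t + 1..t + 2} G \<noteq> 0"
  proof
    assume 0: "integral {t + 1..t + 2} G = 0"
    have "poly f x = 0" if x: "x \<in> {t + 1..t + 2}" for x
    proof -
      have "G x = 0"
      proof (rule has_integral_0_cbox_imp_0[of "t + 1" "t + 2" G x])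
        show "continuous_on (cbox (t + 1) (t + 2)) G" using contG by simp
        show "(G has_integral 0) (cbox (t + 1) (t + 2))"
          using \<open>(G has_integral _) _\<close> 0 by simp
        show "0 \<le> G y" if "y \<in> box (t + 1) (t + 2)" for y
          using FG[of y] nonneg[of y] that by (simp add: box_real)
      qed (use x in auto)
      then show ?thesis using x assms by (auto simp: G_def)
    qed
    then have "{t + 1..t + 2} \<subseteq> {x. poly f x = 0}" by auto
    then have "finite {t + 1..t + 2}"
      using poly_roots_finite[OF f] finite_subset by blast
    then show False by (simp add: infinite_Icc)
  qed
  ultimately show "mfun (moment \<alpha> A B t) (f * f) > 0" using le by linarith
qed

theorem theorem6:
  fixes \<alpha> A B t :: real and n :: nat
  assumes "\<alpha> > 0" and "A \<ge> 0" and "B > 0" and "t > 0" and "n \<ge> 1"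
  defines "H \<equiv> Hn \<alpha> A B n"
  shows "H differentiable (at t) \<and> deriv H differentiable (at t) \<and>
    (t * deriv (deriv H) t)^2 =
      4 * (deriv H t)^2 * (H t - real n * (real n + \<alpha>) - t * deriv H t)
      + ((2 * real n + \<alpha> - t) * deriv H t + H t)^2"
proof -
  define c where "c = (\<lambda>s. B * s powr \<alpha> * exp (- s))"
  interpret jump_moments \<alpha> c "moment \<alpha> A B"
  proof (rule jump_moments.intro)
    fix s :: real assume s: "s > 0"
    show "(c has_real_derivative (\<alpha> - s) / s * c s) (at s)"
      unfolding c_def using s by (auto intro!: derivative_eq_intros simp: powr_diff field_simps)
  qed (use assms pos_functional_moment moment_has_deriv moment_Suc in \<open>auto simp: c_def\<close>)
  obtain k where n: "n = Suc k"
    using assms(5) by (cases n) auto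
  have "H s = - (s * c s * kernel (Suc k) s)" if "s > 0" for s
    unfolding H_def Hn_def hankelD_def n
    using DERIV_imp_deriv[OF ln_hankel_has_deriv[OF that, of "Suc k"]] by simp
  from sigma_form[OF assms(4) this] show ?thesis
    unfolding n .
qed

end
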